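(* Let $A\in M_{d\times d}$ be a matrix with repeated real or complex eigenvalues but no Jordan block with nilpotent components. Arrange the real Jordan canonical form so that $\lambda$, a repeated real eigenvalue or repeated pair of complex eigenvalues, of multiplicity $m\ge2$, corresponds to the first block: $$A=P\begin{pmatrix}J_1&\\&J_2\end{pmatrix}P^{-1},\qquad P=\begin{pmatrix}P_1&P_2\end{pmatrix},$$ where $$J_1=\begin{cases}\lambda I_m,&\lambda\in\mathbb{R},\\ I_m\otimes\begin{pmatrix}a&-b\\ b&a\end{pmatrix},&\lambda=a\pm bi\in\mathbb{C},\ b\neq0.\end{cases}$$ Then $A$ is not identifiable at any $\mathbf{x}_0\in\mathbb{R}^d$. Specifically, for $\mathbf{x}_0\in\mathbb{R}^d$, the $(A,\mathbf{x}_0)$-unidentifiable class $[A]_{\mathbf{x}_0}$ has the following structure: $$\forall B\in[A]_{\mathbf{x}_0},\qquad B=P\begin{pmatrix}J_1+UDU'&\\&J_2\end{pmatrix}P^{-1},$$ where $D$ is an arbitrary matrix in $M_{(m-1)\times(m-1)}$ (for real $\lambda$) or $M_{(2m-2)\times(2m-2)}$ (for complex $\lambda$), and $U$ is a semi-orthogonal matrix such that, with $\mathbf{v}:=\begin{pmatrix}I&\mathbf{0}\end{pmatrix}P^{-1}\mathbf{x}_0$, $$\begin{cases}U\in M_{m\times(m-1)},\quad U'\mathbf{v}=\mathbf{0}_{m-1},&\lambda\in\mathbb{R},\\ U\in M_{2m\times(2m-2)},\quad U'\begin{pmatrix}\mathbf{v}&\bar{\mathbf{v}}\end{pmatrix}=\mathbf{0},&\lambda=a\pm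 bi\in\mathbb{C},\ b\ne0.\end{cases}$$
   Context: $M_{p\times q}$ is the set of real $p\times q$ matrices, $'$ denotes transpose, and $T>0$ is fixed; $\mathbf{x}(t|A,\mathbf{x}_0)=e^{tA}\mathbf{x}_0$. "No Jordan block with nilpotent components" means that $A$ is similar over $\mathbb{R}$ to a block-diagonal matrix with $1\times1$ real blocks and $2\times2$ blocks $\begin{pmatrix}a_k&-b_k\\ b_k&a_k\end{pmatrix}$, $b_k\ne0$ (equivalently, $A$ is diagonalizable over $\mathbb{C}$). $P$ is real and invertible; $P_1$ consists of the first $m$ (real $\lambda$) or $2m$ (complex $\lambda$) columns of $P$, the (generalized) eigenvectors associated with $\lambda$, and $P_2$ of the remaining columns. $\begin{pmatrix}I&\mathbf{0}\end{pmatrix}$ selects the first $m$ (real $\lambda$) or $2m$ (complex $\lambda$) coordinates. In the complex case $\bar{\mathbf{v}}:=\left(I_m\otimes\begin{pmatrix}0&-1\\1&0\end{pmatrix}\right)\mathbf{v}$. A matrix $U$ is semi-orthogonal if $U'U$ is the identity. $A$ is identifiable at $\mathbf{x}_0$ if for all $B\in M_{d\times d}$ with $B\neq A$, $\mathbf{x}(t|A,\mathbf{x}_0)\neq\mathbf{x}(t|B,\mathbf{x}_0)$ for some $0<t<T$. The $(A,\mathbf{x}_0)$-unidentifiable class is $[A]_{\mathbf{x}_0}=\{B\in M_{d\times d}:\ \mathbf{x}(t|A,\mathbf{x}_0)=\mathbf{x}(t|B,\mathbf{x}_0)\text{ for all }t\in[0,T]\}$.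
   Formalization: The inclusion is reversed: such U exist, and each matrix of the displayed form (D arbitrary, U as described) lies in the unidentifiable class. The printed claim that every B in the class has this form is false (A = I, x0 = e1, B = [[1,1],[0,1]]) and is not asserted. *)

theory Defs
  imports Complex_Main "Jordan_Normal_Form.Char_Poly"
begin

text \<open>The entrywise exponential series; it converges absolutely for every square matrix.\<close>

definition mat_exp :: "real mat \<Rightarrow> real mat" where
  "mat_exp A = mat (dim_row A) (dim_row A) (\<lambda>(i, j). \<Sum>k. (A ^\<^sub>m k) $$ (i, j) / fact k)"

definition trajectory :: "real \<Rightarrow> real mat \<Rightarrow> real vec \<Rightarrow> real vec" where
  "trajectory t A x0 = mat_exp (t \<cdot>\<^sub>m A) *\<^sub>v x0"

definition identifiable :: "real \<Rightarrow> real mat \<Rightarrow> real vec \<Rightarrow> bool" where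
  "identifiable T A x0 \<longleftrightarrow>
     (\<forall>B \<in> carrier_mat (dim_row A) (dim_row A). B \<noteq> A \<longrightarrow>
        (\<exists>t. 0 < t \<and> t < T \<and> trajectory t A x0 \<noteq> trajectory t B x0))"

definition unidentifiable_class :: "real \<Rightarrow> real mat \<Rightarrow> real vec \<Rightarrow> real mat set" where
  "unidentifiable_class T A x0 =
     {B \<in> carrier_mat (dim_row A) (dim_row A).
        \<forall>t \<in> {0..T}. trajectory t A x0 = trajectory t B x0}"

definition rot_block :: "real \<Rightarrow> real \<Rightarrow> real mat" where
  "rot_block a b = mat_of_rows_list 2 [[a, -b], [b, a]]"

text \<open>A real Jordan form all of whose blocks are free of nilpotent components.\<close>

definition semisimple_real_form :: "real mat \<Rightarrow> bool" where
  "semisimple_real_form J \<longleftrightarrow>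
     (\<exists>Bs. (\<forall>B \<in> set Bs. (\<exists>a. B = mat_of_rows_list 1 [[a]]) \<or> (\<exists>a b. b \<noteq> 0 \<and> B = rot_block a b))
         \<and> J = diag_block_mat Bs)"

definition no_nilpotent_jordan_block :: "real mat \<Rightarrow> bool" where
  "no_nilpotent_jordan_block A \<longleftrightarrow> (\<exists>J. semisimple_real_form J \<and> similar_mat A J)"

definition kronecker :: "'a::times mat \<Rightarrow> 'a mat \<Rightarrow> 'a mat" where
  "kronecker A B = mat (dim_row A * dim_row B) (dim_col A * dim_col B)
     (\<lambda>(i, j). A $$ (i div dim_row B, j div dim_col B) * B $$ (i mod dim_row B, j mod dim_col B))"

definition block_diag2 :: "'a::zero mat \<Rightarrow> 'a mat \<Rightarrow> 'a mat" where
  "block_diag2 J K = four_block_mat J (0\<^sub>m (dim_row J) (dim_col K)) (0\<^sub>m (dim_row K) (dim_col J)) K"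

text \<open>Real and complex eigenvalues are both given as \<open>\<mu> :: complex\<close>. A non-real \<open>\<mu> = a + bi\<close> stands for
  the pair \<open>a \<plusminus> bi\<close>; either sign of \<open>b\<close> may be chosen, so both orientations of the
  \<open>2 \<times> 2\<close> block are covered.\<close>

definition lead_dim :: "complex \<Rightarrow> nat \<Rightarrow> nat" where
  "lead_dim \<mu> m = (if \<mu> \<in> \<real> then m else 2 * m)"

definition lead_block :: "complex \<Rightarrow> nat \<Rightarrow> real mat" where
  "lead_block \<mu> m =
     (if \<mu> \<in> \<real> then Re \<mu> \<cdot>\<^sub>m 1\<^sub>m m else kronecker (1\<^sub>m m) (rot_block (Re \<mu>) (Im \<mu>)))"

definition perturb_dim :: "complex \<Rightarrow> nat \<Rightarrow> nat" where
  "perturb_dim \<mu> m = (if \<mu> \<in> \<real> then m - 1 else 2 * m - 2)"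

definition bar_vec :: "nat \<Rightarrow> real vec \<Rightarrow> real vec" where
  "bar_vec m v = kronecker (1\<^sub>m m) (mat_of_rows_list 2 [[0, -1], [1, 0]]) *\<^sub>v v"

definition semi_orthogonal :: "real mat \<Rightarrow> bool" where
  "semi_orthogonal U \<longleftrightarrow> U\<^sup>T * U = 1\<^sub>m (dim_col U)"

definition admissible :: "complex \<Rightarrow> nat \<Rightarrow> real vec \<Rightarrow> real mat \<Rightarrow> bool" where
  "admissible \<mu> m v U \<longleftrightarrow> semi_orthogonal U \<and>
     (if \<mu> \<in> \<real>
      then U \<in> carrier_mat m (m - 1) \<and> U\<^sup>T *\<^sub>v v = 0\<^sub>v (m - 1)
      else U \<in> carrier_mat (2 * m) (2 * m - 2) \<and>
           U\<^sup>T * mat_of_cols (2 * m) [v, bar_vec m v] = 0\<^sub>m (2 * m - 2) 2)"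

end

theory Submission
  imports Defs
begin

text \<open>
  In the coordinates given by \<open>P\<close>, the leading block \<open>J\<^sub>1\<close> moves the leading component \<open>v\<close> of the
  initial state inside a very small space: the line spanned by \<open>v\<close> if the eigenvalue is real, and the
  plane spanned by \<open>v\<close> and its rotation \<open>bar v\<close> if it is not. The first holds because \<open>J\<^sub>1\<close> is a scalar
  matrix, the second because \<open>J\<^sub>1 = a I + b R\<close>, where \<open>R v = bar v\<close> and \<open>R R = - I\<close>
  (\<open>kronecker_rot_block_mult_vec\<close>, \<open>bar_vec_kronecker_rot_block\<close>). The columns of an admissible \<open>U\<close> are
  orthogonal to this space, so \<open>U D U\<^sup>T\<close> vanishes on it and the perturbed system never leaves the
  trajectory of the original one.

  To make this precise without computing an exponential of the block matrices, let \<open>W\<close> be the set of all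
  vectors \<open>w\<close> for which \<open>w\<close> (and \<open>bar w\<close> in the non-real case) is killed by \<open>U\<^sup>T\<close>; it is mapped into
  itself by \<open>J\<^sub>1\<close> (\<open>annihilated_vecs_lead_block\<close>). The states whose leading component lies in \<open>W\<close> form a
  set that \<open>A\<close> maps into itself and on which \<open>A\<close> agrees with the perturbed matrix. On such a set all
  powers of the two matrices agree, hence so do the exponentials, which gives equal trajectories
  (\<open>trajectory_eq_on_invariant_set\<close>, \<open>trajectory_perturbed\<close>).

  An admissible \<open>U\<close> exists because the space to be avoided has at most one dimension (two in the
  non-real case), and an orthonormal list of vectors orthogonal to it can be extended as long as fewer
  than all dimensions are used (\<open>semi_orthogonal_annihilator_exists\<close>). Since the multiplicity is at least
  two, \<open>D\<close> has positive size, and \<open>D = 1\<close> already yields a matrix different from \<open>A\<close>: semi-orthogonality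
  makes \<open>D \<mapsto> U D U\<^sup>T\<close> injective (\<open>semi_orthogonal_conjugation_inj\<close>). So \<open>A\<close> is not identifiable.
\<close>

section \<open>Trajectories\<close>

text \<open>The sum of all absolute values of entries dominates every column sum, so it can serve as the ratio
  of a geometric bound. This crude bound is all that the convergence of the exponential series needs.\<close>

lemma pow_mat_entry_bound:
  fixes A :: "real mat"
  assumes A: "A \<in> carrier_mat d d" and "i < d" "j < d"
  shows "\<bar>(A ^\<^sub>m k) $$ (i, j)\<bar> \<le> (\<Sum>q<d. \<Sum>l<d. \<bar>A $$ (l, q)\<bar>) ^ k"
  using \<open>j < d\<close>
proof (induction k arbitrary: j)
  case 0
  then show ?case using assms by auto
next
  case (Suc k)
  let ?C = "\<Sum>q<d. \<Sum>l<d. \<bar>A $$ (l, q)\<bar>"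
  have C0: "?C \<ge> 0" by (intro sum_nonneg) auto
  have "(A ^\<^sub>m Suc k) $$ (i, j) = (\<Sum>l<d. (A ^\<^sub>m k) $$ (i, l) * A $$ (l, j))"
    using A \<open>i < d\<close> Suc.prems
    by (auto simp: scalar_prod_def lessThan_atLeast0 intro!: sum.cong)
  also have "\<bar>\<dots>\<bar> \<le> (\<Sum>l<d. ?C ^ k * \<bar>A $$ (l, j)\<bar>)"
    by (rule order_trans[OF sum_abs]) (auto simp: abs_mult intro!: sum_mono mult_right_mono Suc.IH)
  also have "\<dots> = ?C ^ k * (\<Sum>l<d. \<bar>A $$ (l, j)\<bar>)"
    by (simp add: sum_distrib_left)
  also have "\<dots> \<le> ?C ^ k * ?C"
    using Suc.prems C0
    by (intro mult_left_mono member_le_sum[of j "{..<d}" "\<lambda>q. \<Sum>l<d. \<bar>A $$ (l, q)\<bar>"])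
       (auto intro: sum_nonneg)
  finally show ?case by (simp add: mult.commute)
qed

lemma summable_mat_exp_entry:
  fixes A :: "real mat"
  assumes A: "A \<in> carrier_mat d d" and "i < d" "j < d"
  shows "summable (\<lambda>k. (A ^\<^sub>m k) $$ (i, j) / fact k)"
proof (rule summable_comparison_test)
  let ?C = "\<Sum>q<d. \<Sum>l<d. \<bar>A $$ (l, q)\<bar>"
  show "\<exists>N. \<forall>k\<ge>N. norm ((A ^\<^sub>m k) $$ (i, j) / fact k) \<le> inverse (fact k) * ?C ^ k"
    using pow_mat_entry_bound[OF assms] by (auto simp: field_simps divide_right_mono)
  show "summable (\<lambda>k. inverse (fact k) * ?C ^ k)"
    by (rule summable_exp)
qed

lemma pow_mat_carrier: "A \<in> carrier_mat d d \<Longrightarrow> A ^\<^sub>m k \<in> carrier_mat d d"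
  by (rule carrier_matI) auto

text \<open>The exponential enters only through its action on a vector, which by this formula depends only on
  the images of that vector under the powers of the matrix.\<close>

lemma mat_exp_mult_vec:
  fixes A :: "real mat"
  assumes A: "A \<in> carrier_mat d d" and x: "x \<in> carrier_vec d"
  shows "mat_exp A *\<^sub>v x = vec d (\<lambda>i. \<Sum>k. (A ^\<^sub>m k *\<^sub>v x) $ i / fact k)"
proof (rule eq_vecI)
  fix i assume "i < dim_vec (vec d (\<lambda>i. \<Sum>k. (A ^\<^sub>m k *\<^sub>v x) $ i / fact k))"
  then have i: "i < d" by simp
  have "(mat_exp A *\<^sub>v x) $ i = (\<Sum>j<d. (\<Sum>k. (A ^\<^sub>m k) $$ (i, j) / fact k) * x $ j)"
    using A x i by (auto simp: mat_exp_def scalar_prod_def lessThan_atLeast0 intro!: sum.cong)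
  also have "\<dots> = (\<Sum>j<d. \<Sum>k. (A ^\<^sub>m k) $$ (i, j) / fact k * x $ j)"
    using summable_mat_exp_entry[OF A i] by (intro sum.cong refl suminf_mult2) auto
  also have "\<dots> = (\<Sum>k. \<Sum>j<d. (A ^\<^sub>m k) $$ (i, j) / fact k * x $ j)"
    using summable_mat_exp_entry[OF A i] by (intro suminf_sum[symmetric] summable_mult2) auto
  also have "\<dots> = (\<Sum>k. (A ^\<^sub>m k *\<^sub>v x) $ i / fact k)"
    using A x i
    by (auto simp: scalar_prod_def lessThan_atLeast0 sum_divide_distrib intro!: suminf_cong sum.cong)
  finally show "(mat_exp A *\<^sub>v x) $ i = vec d (\<lambda>i. \<Sum>k. (A ^\<^sub>m k *\<^sub>v x) $ i / fact k) $ i"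
    using i by simp
qed (use A in \<open>auto simp: mat_exp_def\<close>)

lemma smult_mat_mult_vec:
  fixes A :: "'a :: comm_semiring_0 mat"
  assumes "A \<in> carrier_mat n k" and "x \<in> carrier_vec k"
  shows "(c \<cdot>\<^sub>m A) *\<^sub>v x = c \<cdot>\<^sub>v (A *\<^sub>v x)"
  by (rule eq_vecI) (use assms in \<open>auto simp: scalar_prod_def sum_distrib_left mult.assoc\<close>)

text \<open>Because \<open>S\<close> is mapped into itself, each power of \<open>t A\<close> can be turned into the same power of \<open>t B\<close>
  one factor at a time, without leaving \<open>S\<close>. Closure under scaling absorbs the factor \<open>t\<close>.\<close>

lemma trajectory_eq_on_invariant_set:
  assumes A: "A \<in> carrier_mat d d" and B: "B \<in> carrier_mat d d"
    and S: "S \<subseteq> carrier_vec d"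
    and smult: "\<And>c x. x \<in> S \<Longrightarrow> c \<cdot>\<^sub>v x \<in> S"
    and invariant: "\<And>x. x \<in> S \<Longrightarrow> A *\<^sub>v x \<in> S"
    and agree: "\<And>x. x \<in> S \<Longrightarrow> A *\<^sub>v x = B *\<^sub>v x"
    and x: "x \<in> S"
  shows "trajectory t A x = trajectory t B x"
proof -
  let ?A = "t \<cdot>\<^sub>m A" and ?B = "t \<cdot>\<^sub>m B"
  have tA: "?A \<in> carrier_mat d d" and tB: "?B \<in> carrier_mat d d" using A B by auto
  have step: "?A *\<^sub>v y = ?B *\<^sub>v y" "?A *\<^sub>v y \<in> S" if "y \<in> S" for y
  proof -
    have y: "y \<in> carrier_vec d" using S that by auto
    have "?A *\<^sub>v y = t \<cdot>\<^sub>v (A *\<^sub>v y)" "?B *\<^sub>v y = t \<cdot>\<^sub>v (B *\<^sub>v y)"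
      using A B y by (auto intro: smult_mat_mult_vec)
    then show "?A *\<^sub>v y = ?B *\<^sub>v y" "?A *\<^sub>v y \<in> S"
      using agree[OF that] smult[OF invariant[OF that]] by auto
  qed
  have "?A ^\<^sub>m k *\<^sub>v y = ?B ^\<^sub>m k *\<^sub>v y" if "y \<in> S" for k y
    using that
  proof (induction k arbitrary: y)
    case 0
    then show ?case using A B S by auto
  next
    case (Suc k)
    have y: "y \<in> carrier_vec d" using S Suc.prems by auto
    have "?A ^\<^sub>m Suc k *\<^sub>v y = ?A ^\<^sub>m k *\<^sub>v (?A *\<^sub>v y)"
      using assoc_mult_mat_vec[OF pow_mat_carrier[OF tA] tA y] by simp
    also have "\<dots> = ?B ^\<^sub>m k *\<^sub>v (?A *\<^sub>v y)"
      using Suc step by blast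
    also have "\<dots> = ?B ^\<^sub>m Suc k *\<^sub>v y"
      using assoc_mult_mat_vec[OF pow_mat_carrier[OF tB] tB y] step(1)[OF Suc.prems] by simp
    finally show ?case .
  qed
  then show ?thesis
    using x S tA tB by (auto simp: trajectory_def mat_exp_mult_vec)
qed

section \<open>Semi-orthogonal matrices with prescribed annihilated vectors\<close>

text \<open>Fewer than \<open>n\<close> linear conditions in \<open>n\<close> unknowns leave a non-trivial solution: padded with zero
  rows, the system is square with determinant zero.\<close>

lemma unit_vector_orthogonal_to_few:
  fixes vs :: "real vec list"
  assumes vs: "set vs \<subseteq> carrier_vec n" and few: "length vs < n"
  shows "\<exists>x \<in> carrier_vec n. x \<bullet> x = 1 \<and> (\<forall>w \<in> set vs. w \<bullet> x = 0)"
proof -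
  define c where "c i = (if i < length vs then vs ! i else 0\<^sub>v n)" for i
  define M where "M = mat\<^sub>r n n (\<lambda>i. if i = length vs then 0\<^sub>v n else c i)"
  have c: "c i \<in> carrier_vec n" for i
    using vs by (auto simp: c_def)
  have "det M = 0"
    unfolding M_def using few c by (intro det_row_0) auto
  moreover have "M \<in> carrier_mat n n" by (auto simp: M_def)
  ultimately obtain y where y: "y \<in> carrier_vec n" "y \<noteq> 0\<^sub>v n" "M *\<^sub>v y = 0\<^sub>v n"
    using det_0_iff_vec_prod_zero_field by blast
  have orth: "w \<bullet> y = 0" if w: "w \<in> set vs" for w
  proof -
    obtain i where i: "i < length vs" "w = vs ! i"
      using w by (auto simp: in_set_conv_nth)
    have "row M i = w"
      using i few c[of i] by (auto simp: M_def c_def)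
    moreover have "(M *\<^sub>v y) $ i = row M i \<bullet> y"
      using i few by (intro index_mult_mat_vec) (auto simp: M_def)
    ultimately show ?thesis using y(3) i few by simp
  qed
  have pos: "y \<bullet> y > 0"
    using conjugate_square_greater_0_vec[OF y(1)] y(2) by simp
  let ?x = "(1 / sqrt (y \<bullet> y)) \<cdot>\<^sub>v y"
  have "?x \<bullet> ?x = 1"
    using y(1) pos by (simp add: real_div_sqrt field_simps flip: power2_eq_square)
  moreover have "w \<bullet> ?x = 0" if "w \<in> set vs" for w
    using orth[OF that] that vs y(1) by (auto simp: scalar_prod_smult_right)
  ultimately show ?thesis using y(1) by (intro bexI[of _ ?x]) auto
qed

lemma orthonormal_list_exists:
  fixes ws :: "real vec list"
  assumes "set ws \<subseteq> carrier_vec n" and "k + length ws \<le> n"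
  shows "\<exists>us. length us = k \<and> set us \<subseteq> carrier_vec n \<and>
           (\<forall>i<k. \<forall>j<k. us ! i \<bullet> us ! j = (if i = j then 1 else 0)) \<and>
           (\<forall>u \<in> set us. \<forall>w \<in> set ws. u \<bullet> w = 0)"
  using assms(2)
proof (induction k)
  case 0
  then show ?case by auto
next
  case (Suc k)
  then obtain us where us: "length us = k" "set us \<subseteq> carrier_vec n"
    "\<forall>i<k. \<forall>j<k. us ! i \<bullet> us ! j = (if i = j then 1 else 0)"
    "\<forall>u \<in> set us. \<forall>w \<in> set ws. u \<bullet> w = 0"
    by auto
  obtain x where x: "x \<in> carrier_vec n" "x \<bullet> x = 1" "\<forall>w \<in> set (us @ ws). w \<bullet> x = 0"
    using unit_vector_orthogonal_to_few[of "us @ ws" n] us assms(1) Suc.prems by auto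
  have comm: "x \<bullet> w = 0" if "w \<in> set (us @ ws)" for w
    using x that us(2) assms(1) comm_scalar_prod[OF x(1), of w] by auto
  show ?case
  proof (intro exI[of _ "us @ [x]"] conjI allI impI)
    fix i j assume ij: "i < Suc k" "j < Suc k"
    have old: "x \<bullet> us ! l = 0" "us ! l \<bullet> x = 0" if "l < k" for l
      using comm[of "us ! l"] x(3) us(1) that by auto
    consider "i < k" "j < k" | "i < k" "j = k" | "i = k" "j < k" | "i = k" "j = k"
      using ij by linarith
    then show "(us @ [x]) ! i \<bullet> (us @ [x]) ! j = (if i = j then 1 else 0)"
      by cases (simp_all add: nth_append us(1,3) x(2) old)
  qed (use us x comm in auto)
qed

lemma semi_orthogonal_annihilator_exists:
  fixes ws :: "real vec list"
  assumes "set ws \<subseteq> carrier_vec n" and "k + length ws \<le> n"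
  shows "\<exists>U \<in> carrier_mat n k. semi_orthogonal U \<and> (\<forall>w \<in> set ws. U\<^sup>T *\<^sub>v w = 0\<^sub>v k)"
proof -
  obtain us where us: "length us = k" "set us \<subseteq> carrier_vec n"
    "\<forall>i<k. \<forall>j<k. us ! i \<bullet> us ! j = (if i = j then 1 else 0)"
    "\<forall>u \<in> set us. \<forall>w \<in> set ws. u \<bullet> w = 0"
    using orthonormal_list_exists[OF assms] by auto
  let ?U = "mat_of_cols n us"
  have col: "col ?U i = us ! i" if "i < k" for i
    using us that by (intro col_mat_of_cols) auto
  have "semi_orthogonal ?U"
    unfolding semi_orthogonal_def
    by (rule eq_matI) (use us col in auto)
  moreover have "?U\<^sup>T *\<^sub>v w = 0\<^sub>v k" if "w \<in> set ws" for w
    by (rule eq_vecI) (use us col that in auto)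
  ultimately show ?thesis
    using us(1) by (intro bexI[of _ ?U]) auto
qed

section \<open>The leading Jordan block\<close>

lemma kronecker_carrier:
  "A \<in> carrier_mat p q \<Longrightarrow> B \<in> carrier_mat r s \<Longrightarrow> kronecker A B \<in> carrier_mat (p * r) (q * s)"
  by (auto simp: kronecker_def)

text \<open>The mixed-product property. The index \<open>l\<close> of the inner sum runs over pairs
  \<open>(l div s, l mod s)\<close>, so the sum factors.\<close>

lemma kronecker_mult:
  fixes A B C D :: "'a :: comm_semiring_1 mat"
  assumes A: "A \<in> carrier_mat p q" and B: "B \<in> carrier_mat r s"
    and C: "C \<in> carrier_mat q u" and D: "D \<in> carrier_mat s w"
  shows "kronecker A B * kronecker C D = kronecker (A * C) (B * D)"
proof (rule eq_matI)
  fix i j assume "i < dim_row (kronecker (A * C) (B * D))" "j < dim_col (kronecker (A * C) (B * D))"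
  then have i: "i < p * r" and j: "j < u * w"
    using assms by (auto simp: kronecker_def)
  have r: "r > 0" and w: "w > 0" using i j by (auto intro: gr0I)
  have id: "i div r < p" "i mod r < r" and jd: "j div w < u" "j mod w < w"
    using i j r w by (auto simp: less_mult_imp_div_less)
  let ?f = "\<lambda>l. A $$ (i div r, l div s) * B $$ (i mod r, l mod s) *
                 (C $$ (l div s, j div w) * D $$ (l mod s, j mod w))"
  have "(kronecker A B * kronecker C D) $$ (i, j) = (\<Sum>l<q * s. ?f l)"
    using assms i j
    by (auto simp: kronecker_def scalar_prod_def lessThan_atLeast0 intro!: sum.cong)
  also have "\<dots> = (\<Sum>g<q. sum ?f {g * s..<g * s + s})"
    by (rule sum.nat_group[symmetric])
  also have "\<dots> = (\<Sum>g<q. \<Sum>h<s. ?f (h + g * s))"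
  proof (rule sum.cong[OF refl])
    fix g
    show "sum ?f {g * s..<g * s + s} = (\<Sum>h<s. ?f (h + g * s))"
      using sum.shift_bounds_nat_ivl[of ?f 0 "g * s" s]
      by (simp only: lessThan_atLeast0 add_0 add.commute[of s])
  qed
  also have "\<dots> = (\<Sum>g<q. \<Sum>h<s. (A $$ (i div r, g) * C $$ (g, j div w)) *
                                 (B $$ (i mod r, h) * D $$ (h, j mod w)))"
    by (intro sum.cong refl) (auto simp: ac_simps)
  also have "\<dots> = (\<Sum>g<q. A $$ (i div r, g) * C $$ (g, j div w)) *
                  (\<Sum>h<s. B $$ (i mod r, h) * D $$ (h, j mod w))"
    by (simp add: sum_product)
  also have "\<dots> = kronecker (A * C) (B * D) $$ (i, j)"
    using assms i j id jd
    by (auto simp: kronecker_def scalar_prod_def lessThan_atLeast0 intro!: arg_cong2[of _ _ _ _ "(*)"] sum.cong)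
  finally show "(kronecker A B * kronecker C D) $$ (i, j) = kronecker (A * C) (B * D) $$ (i, j)" .
qed (use assms in \<open>auto simp: kronecker_def\<close>)

lemma rot_block_carrier: "rot_block a b \<in> carrier_mat 2 2"
  by (auto simp: rot_block_def mat_of_rows_list_def)

text \<open>The blocks multiply like the complex numbers \<open>a + bi\<close>.\<close>

lemma rot_block_mult:
  "rot_block a b * rot_block c e = rot_block (a * c - b * e) (a * e + b * c)"
  by (rule eq_matI)
     (auto simp: rot_block_def mat_of_rows_list_def scalar_prod_def numeral_2_eq_2 less_Suc_eq algebra_simps)

lemma bar_vec_eq: "bar_vec m v = kronecker (1\<^sub>m m) (rot_block 0 1) *\<^sub>v v"
  by (simp add: bar_vec_def rot_block_def)

lemma kronecker_rot_block_carrier: "kronecker (1\<^sub>m m) (rot_block a b) \<in> carrier_mat (2 * m) (2 * m)"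
  using kronecker_carrier[OF one_carrier_mat rot_block_carrier] by (simp add: mult.commute)

lemma kronecker_rot_block_index:
  assumes "i < m * 2" and "j < m * 2"
  shows "kronecker (1\<^sub>m m) (rot_block a b) $$ (i, j) =
    (if i div 2 \<noteq> j div 2 then 0 else if i mod 2 = j mod 2 then a else if i mod 2 = 0 then - b else b)"
proof -
  have entry: "rot_block a b $$ (p, q) = (if p = q then a else if p = 0 then - b else b)"
    if "p < 2" "q < 2" for p q
    using that by (auto simp: rot_block_def mat_of_rows_list_def less_2_cases_iff)
  have "kronecker (1\<^sub>m m) (rot_block a b) $$ (i, j) =
      1\<^sub>m m $$ (i div 2, j div 2) * rot_block a b $$ (i mod 2, j mod 2)"
    using assms rot_block_carrier[of a b] by (auto simp: kronecker_def)
  then show ?thesis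
    using less_mult_imp_div_less[OF assms(1)] less_mult_imp_div_less[OF assms(2)]
    by (simp add: entry)
qed

lemma bar_vec_carrier: "v \<in> carrier_vec (2 * m) \<Longrightarrow> bar_vec m v \<in> carrier_vec (2 * m)"
  unfolding bar_vec_eq using kronecker_rot_block_carrier by (rule mult_mat_vec_carrier)

text \<open>The complex block acts as \<open>a + b R\<close>, where \<open>R\<close> is the operation \<open>bar_vec\<close>. Together with the next
  lemma, which adds \<open>R R = - 1\<close>, this keeps the span of \<open>v\<close> and \<open>R v\<close> invariant.\<close>

lemma kronecker_rot_block_mult_vec:
  assumes v: "v \<in> carrier_vec (2 * m)"
  shows "kronecker (1\<^sub>m m) (rot_block a b) *\<^sub>v v = a \<cdot>\<^sub>v v + b \<cdot>\<^sub>v bar_vec m v"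
proof -
  have "kronecker (1\<^sub>m m) (rot_block a b) = a \<cdot>\<^sub>m 1\<^sub>m (2 * m) + b \<cdot>\<^sub>m kronecker (1\<^sub>m m) (rot_block 0 1)"
  proof (rule eq_matI)
    fix i j
    assume "i < dim_row (a \<cdot>\<^sub>m 1\<^sub>m (2 * m) + b \<cdot>\<^sub>m kronecker (1\<^sub>m m) (rot_block 0 1))"
      and "j < dim_col (a \<cdot>\<^sub>m 1\<^sub>m (2 * m) + b \<cdot>\<^sub>m kronecker (1\<^sub>m m) (rot_block 0 1))"
    then have ij: "i < m * 2" "j < m * 2"
      using kronecker_rot_block_carrier[of m 0 1] by auto
    have same: "i = j \<longleftrightarrow> i div 2 = j div 2 \<and> i mod 2 = j mod 2"
      by (metis div_mult_mod_eq)
    have "(a \<cdot>\<^sub>m 1\<^sub>m (2 * m) + b \<cdot>\<^sub>m kronecker (1\<^sub>m m) (rot_block 0 1)) $$ (i, j) =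
        (if i = j then a else 0) + b * kronecker (1\<^sub>m m) (rot_block 0 1) $$ (i, j)"
      using ij kronecker_rot_block_carrier[of m 0 1] by auto
    then show "kronecker (1\<^sub>m m) (rot_block a b) $$ (i, j) =
        (a \<cdot>\<^sub>m 1\<^sub>m (2 * m) + b \<cdot>\<^sub>m kronecker (1\<^sub>m m) (rot_block 0 1)) $$ (i, j)"
      using ij same by (simp add: kronecker_rot_block_index)
  qed (use kronecker_rot_block_carrier[of m a b] kronecker_rot_block_carrier[of m 0 1] in auto)
  then show ?thesis
    using v kronecker_rot_block_carrier[of m 0 1]
    by (auto simp: add_mult_distrib_mat_vec[of _ "2 * m" "2 * m"] bar_vec_eq
        smult_mat_mult_vec[of _ "2 * m" "2 * m"])
qed

lemma bar_vec_kronecker_rot_block: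
  assumes v: "v \<in> carrier_vec (2 * m)"
  shows "bar_vec m (kronecker (1\<^sub>m m) (rot_block a b) *\<^sub>v v) = (- b) \<cdot>\<^sub>v v + a \<cdot>\<^sub>v bar_vec m v"
proof -
  have "bar_vec m (kronecker (1\<^sub>m m) (rot_block a b) *\<^sub>v v) =
      (kronecker (1\<^sub>m m) (rot_block 0 1) * kronecker (1\<^sub>m m) (rot_block a b)) *\<^sub>v v"
    unfolding bar_vec_eq
    by (rule assoc_mult_mat_vec[OF kronecker_rot_block_carrier kronecker_rot_block_carrier v, symmetric])
  also have "\<dots> = kronecker (1\<^sub>m m) (rot_block (- b) a) *\<^sub>v v"
    by (simp add: kronecker_mult[OF one_carrier_mat rot_block_carrier one_carrier_mat rot_block_carrier]
        rot_block_mult)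
  finally show ?thesis by (simp add: kronecker_rot_block_mult_vec[OF v])
qed

lemma lead_block_carrier: "lead_block \<mu> m \<in> carrier_mat (lead_dim \<mu> m) (lead_dim \<mu> m)"
  using kronecker_rot_block_carrier by (auto simp: lead_block_def lead_dim_def)

lemma mat_mult_vec_combination_eq_0:
  fixes M :: "'a :: field mat"
  assumes M: "M \<in> carrier_mat k n" and v: "v \<in> carrier_vec n" and w: "w \<in> carrier_vec n"
    and "M *\<^sub>v v = 0\<^sub>v k" and "M *\<^sub>v w = 0\<^sub>v k"
  shows "M *\<^sub>v (a \<cdot>\<^sub>v v + b \<cdot>\<^sub>v w) = 0\<^sub>v k"
proof -
  have "M *\<^sub>v (a \<cdot>\<^sub>v v + b \<cdot>\<^sub>v w) = a \<cdot>\<^sub>v (M *\<^sub>v v) + b \<cdot>\<^sub>v (M *\<^sub>v w)"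
    using M v w by (simp add: mult_add_distrib_mat_vec[OF M] mult_mat_vec[OF M])
  then show ?thesis using assms by auto
qed

text \<open>In the non-real case the condition on \<open>bar_vec m w\<close> is what makes the set invariant under the leading
  block, since the block sends \<open>w\<close> to a combination of \<open>w\<close> and \<open>bar_vec m w\<close>.\<close>

definition annihilated_vecs :: "complex \<Rightarrow> nat \<Rightarrow> real mat \<Rightarrow> real vec set" where
  "annihilated_vecs \<mu> m U = {w \<in> carrier_vec (lead_dim \<mu> m).
     U\<^sup>T *\<^sub>v w = 0\<^sub>v (dim_col U) \<and> (\<mu> \<notin> \<real> \<longrightarrow> U\<^sup>T *\<^sub>v bar_vec m w = 0\<^sub>v (dim_col U))}"

lemma two_column_product_eq_0_iff:
  fixes M :: "'a :: comm_ring_1 mat"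
  assumes M: "M \<in> carrier_mat k n" and v: "v \<in> carrier_vec n" and w: "w \<in> carrier_vec n"
  shows "M * mat_of_cols n [v, w] = 0\<^sub>m k 2 \<longleftrightarrow> M *\<^sub>v v = 0\<^sub>v k \<and> M *\<^sub>v w = 0\<^sub>v k"
proof -
  let ?N = "mat_of_cols n [v, w]"
  have N: "?N \<in> carrier_mat n 2" by (auto simp: numeral_2_eq_2)
  have cols: "col (M * ?N) 0 = M *\<^sub>v v" "col (M * ?N) 1 = M *\<^sub>v w"
    using M N v w by (auto simp: col_mult2[OF M N])
  show ?thesis
  proof
    assume "M * ?N = 0\<^sub>m k 2"
    then show "M *\<^sub>v v = 0\<^sub>v k \<and> M *\<^sub>v w = 0\<^sub>v k" using cols by auto
  next
    assume *: "M *\<^sub>v v = 0\<^sub>v k \<and> M *\<^sub>v w = 0\<^sub>v k"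
    show "M * ?N = 0\<^sub>m k 2"
    proof (rule mat_col_eqI)
      fix j assume "j < dim_col (0\<^sub>m k 2 :: 'a mat)"
      then have "j = 0 \<or> j = 1" by auto
      then show "col (M * ?N) j = col (0\<^sub>m k 2) j" using * cols by auto
    qed (use M N in auto)
  qed
qed

text \<open>From here on the real and the non-real case of the theorem are treated together: admissibility
  says that \<open>v\<close> lies in the invariant set attached to \<open>U\<close>.\<close>

lemma admissible_iff:
  assumes v: "v \<in> carrier_vec (lead_dim \<mu> m)"
  shows "admissible \<mu> m v U \<longleftrightarrow> semi_orthogonal U \<and>
    U \<in> carrier_mat (lead_dim \<mu> m) (perturb_dim \<mu> m) \<and> v \<in> annihilated_vecs \<mu> m U"
proof (cases "\<mu> \<in> \<real>")
  case True
  then show ?thesis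
    using v by (auto simp: admissible_def annihilated_vecs_def lead_dim_def perturb_dim_def)
next
  case False
  have "U\<^sup>T * mat_of_cols (2 * m) [v, bar_vec m v] = 0\<^sub>m (2 * m - 2) 2 \<longleftrightarrow>
      U\<^sup>T *\<^sub>v v = 0\<^sub>v (2 * m - 2) \<and> U\<^sup>T *\<^sub>v bar_vec m v = 0\<^sub>v (2 * m - 2)"
    if "U \<in> carrier_mat (2 * m) (2 * m - 2)"
    using that v False bar_vec_carrier[of v m]
    by (intro two_column_product_eq_0_iff) (auto simp: lead_dim_def)
  then show ?thesis
    using v False by (auto simp: admissible_def annihilated_vecs_def lead_dim_def perturb_dim_def)
qed

lemma admissible_exists:
  assumes v: "v \<in> carrier_vec (lead_dim \<mu> m)" and m: "m \<ge> 1"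
  shows "\<exists>U. admissible \<mu> m v U"
proof -
  let ?ws = "if \<mu> \<in> \<real> then [v] else [v, bar_vec m v]"
  have "set ?ws \<subseteq> carrier_vec (lead_dim \<mu> m)"
    using v bar_vec_carrier[of v m] by (auto simp: lead_dim_def)
  moreover have "perturb_dim \<mu> m + length ?ws \<le> lead_dim \<mu> m"
    using m by (auto simp: lead_dim_def perturb_dim_def)
  ultimately obtain U where "U \<in> carrier_mat (lead_dim \<mu> m) (perturb_dim \<mu> m)"
    "semi_orthogonal U" "\<forall>w \<in> set ?ws. U\<^sup>T *\<^sub>v w = 0\<^sub>v (perturb_dim \<mu> m)"
    using semi_orthogonal_annihilator_exists by blast
  then show ?thesis
    using v by (auto simp: admissible_iff[OF v] annihilated_vecs_def split: if_splits)
qed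

lemma annihilated_vecs_smult:
  assumes U: "U \<in> carrier_mat (lead_dim \<mu> m) k" and w: "w \<in> annihilated_vecs \<mu> m U"
  shows "c \<cdot>\<^sub>v w \<in> annihilated_vecs \<mu> m U"
proof -
  have Ut: "U\<^sup>T \<in> carrier_mat k (lead_dim \<mu> m)" and wc: "w \<in> carrier_vec (lead_dim \<mu> m)"
    using U w by (auto simp: annihilated_vecs_def)
  have "U\<^sup>T *\<^sub>v bar_vec m (c \<cdot>\<^sub>v w) = c \<cdot>\<^sub>v (U\<^sup>T *\<^sub>v bar_vec m w)" if "\<mu> \<notin> \<real>"
    using that wc Ut bar_vec_carrier[of w m]
    by (simp add: bar_vec_eq mult_mat_vec[OF kronecker_rot_block_carrier] lead_dim_def mult_mat_vec)
  then show ?thesis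
    using w U wc by (auto simp: annihilated_vecs_def mult_mat_vec[OF Ut])
qed

lemma annihilated_vecs_lead_block:
  assumes U: "U \<in> carrier_mat (lead_dim \<mu> m) k" and w: "w \<in> annihilated_vecs \<mu> m U"
  shows "lead_block \<mu> m *\<^sub>v w \<in> annihilated_vecs \<mu> m U"
proof (cases "\<mu> \<in> \<real>")
  case True
  have wc: "w \<in> carrier_vec m"
    using w True by (auto simp: annihilated_vecs_def lead_dim_def)
  have "lead_block \<mu> m *\<^sub>v w = Re \<mu> \<cdot>\<^sub>v w"
    using True wc by (simp add: lead_block_def smult_mat_mult_vec[of _ m m])
  then show ?thesis using annihilated_vecs_smult[OF U w] by simp
next
  case False
  let ?L = "kronecker (1\<^sub>m m) (rot_block (Re \<mu>) (Im \<mu>))"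
  have Ut: "U\<^sup>T \<in> carrier_mat k (2 * m)" and wc: "w \<in> carrier_vec (2 * m)"
    and w0: "U\<^sup>T *\<^sub>v w = 0\<^sub>v k" "U\<^sup>T *\<^sub>v bar_vec m w = 0\<^sub>v k"
    using U w False by (auto simp: annihilated_vecs_def lead_dim_def)
  note combination = mat_mult_vec_combination_eq_0[OF Ut wc bar_vec_carrier[OF wc] w0]
  have "U\<^sup>T *\<^sub>v (?L *\<^sub>v w) = 0\<^sub>v k"
    unfolding kronecker_rot_block_mult_vec[OF wc] by (rule combination)
  moreover have "U\<^sup>T *\<^sub>v bar_vec m (?L *\<^sub>v w) = 0\<^sub>v k"
    unfolding bar_vec_kronecker_rot_block[OF wc] by (rule combination)
  moreover have "?L *\<^sub>v w \<in> carrier_vec (2 * m)"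
    using kronecker_rot_block_carrier wc by (rule mult_mat_vec_carrier)
  ultimately show ?thesis
    using False U by (simp add: annihilated_vecs_def lead_block_def lead_dim_def)
qed

section \<open>Perturbing the leading block\<close>

lemma block_diag2_carrier:
  "J \<in> carrier_mat n n \<Longrightarrow> K \<in> carrier_mat r r \<Longrightarrow> block_diag2 J K \<in> carrier_mat (n + r) (n + r)"
  by (simp add: block_diag2_def)

lemma block_diag2_mult_vec:
  fixes J K :: "'a :: comm_semiring_1 mat"
  assumes "J \<in> carrier_mat n n" "K \<in> carrier_mat r r" "a \<in> carrier_vec n" "e \<in> carrier_vec r"
  shows "block_diag2 J K *\<^sub>v (a @\<^sub>v e) = (J *\<^sub>v a) @\<^sub>v (K *\<^sub>v e)"
  using mult_mat_vec_split[OF assms] assms by (simp add: block_diag2_def)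

lemma vec_first_append:
  "a \<in> carrier_vec n \<Longrightarrow> vec_first (a @\<^sub>v e) n = a"
  by (auto simp: vec_first_def)

text \<open>A perturbation \<open>E\<close> of the first diagonal block cannot be seen from an initial state whose leading
  component lies in a set \<open>W\<close> that \<open>L\<close> maps into itself and \<open>E\<close> sends to zero. The invariant set of
  states is the preimage of \<open>W\<close> under passage to the coordinates of \<open>P\<close>.\<close>

lemma trajectory_perturbed:
  assumes A: "A \<in> carrier_mat (n + r) (n + r)"
    and sim: "similar_mat_wit A (block_diag2 L K) P Q"
    and L: "L \<in> carrier_mat n n" and K: "K \<in> carrier_mat r r" and E: "E \<in> carrier_mat n n"
    and W: "W \<subseteq> carrier_vec n" "\<And>c w. w \<in> W \<Longrightarrow> c \<cdot>\<^sub>v w \<in> W" "\<And>w. w \<in> W \<Longrightarrow> L *\<^sub>v w \<in> W"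
    and E0: "\<And>w. w \<in> W \<Longrightarrow> E *\<^sub>v w = 0\<^sub>v n"
    and x: "x \<in> carrier_vec (n + r)" "vec_first (Q *\<^sub>v x) n \<in> W"
  shows "trajectory t A x = trajectory t (P * block_diag2 (L + E) K * Q) x"
proof -
  let ?S = "{y \<in> carrier_vec (n + r). vec_first (Q *\<^sub>v y) n \<in> W}"
  let ?B = "P * block_diag2 (L + E) K * Q"
  note D = similar_mat_witD2[OF A sim]
  note P = D(6) and Q = D(7)
  have BL: "block_diag2 (L + E) K \<in> carrier_mat (n + r) (n + r)"
    using L E K by (intro block_diag2_carrier) auto
  have mult: "(P * M * Q) *\<^sub>v y = P *\<^sub>v (M *\<^sub>v (Q *\<^sub>v y))"
    if "M \<in> carrier_mat (n + r) (n + r)" "y \<in> carrier_vec (n + r)" for M y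
    using that P Q by (simp add: assoc_mult_mat_vec[of _ "n + r" "n + r" _ "n + r"])
  show ?thesis
  proof (rule trajectory_eq_on_invariant_set[where S = ?S])
    fix y assume y: "y \<in> ?S"
    let ?a = "vec_first (Q *\<^sub>v y) n" and ?e = "vec_last (Q *\<^sub>v y) r"
    have yc: "y \<in> carrier_vec (n + r)" and a: "?a \<in> W" using y by auto
    have Qy: "Q *\<^sub>v y \<in> carrier_vec (n + r)" using Q yc by simp
    have split: "Q *\<^sub>v y = ?a @\<^sub>v ?e" using Qy by simp
    have LE: "(L + E) *\<^sub>v ?a = L *\<^sub>v ?a"
      using L E E0[OF a] by (simp add: add_mult_distrib_mat_vec[of _ n n])
    have blocks: "block_diag2 L K *\<^sub>v (Q *\<^sub>v y) = (L *\<^sub>v ?a) @\<^sub>v (K *\<^sub>v ?e)"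
      "block_diag2 (L + E) K *\<^sub>v (Q *\<^sub>v y) = (L *\<^sub>v ?a) @\<^sub>v (K *\<^sub>v ?e)"
      using block_diag2_mult_vec[OF L K, of ?a ?e] block_diag2_mult_vec[of "L + E" n K r ?a ?e]
        L E K LE split by auto
    show "A *\<^sub>v y = ?B *\<^sub>v y"
      using mult[OF D(5) yc] mult[OF BL yc] unfolding blocks D(3)[symmetric] by argo
    have "A *\<^sub>v y = P *\<^sub>v ((L *\<^sub>v ?a) @\<^sub>v (K *\<^sub>v ?e))"
      using mult[OF D(5) yc] unfolding blocks(1) D(3)[symmetric] .
    moreover have LK: "(L *\<^sub>v ?a) @\<^sub>v (K *\<^sub>v ?e) \<in> carrier_vec (n + r)"
      using L K by (intro append_carrier_vec mult_mat_vec_carrier) auto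
    ultimately have "Q *\<^sub>v (A *\<^sub>v y) = (L *\<^sub>v ?a) @\<^sub>v (K *\<^sub>v ?e)"
      using assoc_mult_mat_vec[OF Q P LK] D(2) by simp
    then show "A *\<^sub>v y \<in> ?S"
      using A yc W(3)[OF a] L by (simp add: vec_first_append)
  next
    fix c y assume y: "y \<in> ?S"
    have "vec_first (Q *\<^sub>v (c \<cdot>\<^sub>v y)) n = c \<cdot>\<^sub>v vec_first (Q *\<^sub>v y) n"
      using y Q by (auto simp: vec_first_def mult_mat_vec[OF Q])
    then show "c \<cdot>\<^sub>v y \<in> ?S" using y W(2) by simp
  qed (use A P Q BL x in auto)
qed

text \<open>Multiplying by \<open>U\<^sup>T\<close> from the left and by \<open>U\<close> from the right recovers \<open>D\<close>.\<close>

lemma semi_orthogonal_conjugation_inj: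
  assumes U: "U \<in> carrier_mat n k" and "semi_orthogonal U"
    and D: "D \<in> carrier_mat k k" and "U * D * U\<^sup>T = 0\<^sub>m n n"
  shows "D = 0\<^sub>m k k"
proof -
  have UU: "U\<^sup>T * U = 1\<^sub>m k" using assms by (simp add: semi_orthogonal_def)
  have Ut: "U\<^sup>T \<in> carrier_mat k n" using U by simp
  have UD: "U * D \<in> carrier_mat n k" using U D by simp
  have "D = (U\<^sup>T * U) * D * (U\<^sup>T * U)"
    using UU D by simp
  also have "\<dots> = U\<^sup>T * (U * D * U\<^sup>T) * U"
    using assoc_mult_mat[OF Ut U D] assoc_mult_mat[OF Ut UD Ut]
      assoc_mult_mat[of "U\<^sup>T * (U * D)" k k "U\<^sup>T" n U k] U Ut UD by simp
  also have "\<dots> = 0\<^sub>m k k"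
    using assms(4) U Ut by simp
  finally show ?thesis .
qed

lemma similar_mat_conjugation_cancel:
  fixes P Q M N :: "'a :: semiring_1 mat"
  assumes PQ: "Q * P = 1\<^sub>m n" and P: "P \<in> carrier_mat n n" and Q: "Q \<in> carrier_mat n n"
    and M: "M \<in> carrier_mat n n" and N: "N \<in> carrier_mat n n"
    and eq: "P * M * Q = P * N * Q"
  shows "M = N"
proof -
  have cancel: "Q * (P * X * Q) * P = X" if X: "X \<in> carrier_mat n n" for X
  proof -
    have "Q * (P * X * Q) * P = (Q * P) * X * (Q * P)"
      using X P Q by (simp add: assoc_mult_mat[of _ n n _ n _ n])
    then show ?thesis
      unfolding PQ left_mult_one_mat[OF X] right_mult_one_mat[OF X] .
  qed
  show ?thesis using cancel[OF M] unfolding eq cancel[OF N] by (rule sym)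
qed

lemma block_diag2_eqD:
  assumes "J \<in> carrier_mat n n" "J' \<in> carrier_mat n n" "K \<in> carrier_mat r r"
    and eq: "block_diag2 J K = block_diag2 J' K"
  shows "J = J'"
proof (rule eq_matI)
  fix i j assume ij: "i < dim_row J'" "j < dim_col J'"
  have "block_diag2 M K $$ (i, j) = M $$ (i, j)" if "M \<in> carrier_mat n n" for M
    using assms(2,3) that ij by (simp add: block_diag2_def)
  then show "J $$ (i, j) = J' $$ (i, j)"
    using assms by metis
qed (use assms in auto)

lemma add_eq_self_mat:
  fixes M E :: "'a :: group_add mat"
  assumes M: "M \<in> carrier_mat n k" and E: "E \<in> carrier_mat n k" and eq: "M + E = M"
  shows "E = 0\<^sub>m n k"
proof (rule eq_matI)
  fix i j assume "i < dim_row (0\<^sub>m n k :: 'a mat)" "j < dim_col (0\<^sub>m n k :: 'a mat)"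
  then have ij: "i < n" "j < k" by auto
  have "(M + E) $$ (i, j) = M $$ (i, j) + E $$ (i, j)"
    using ij E by (intro index_add_mat(1)) auto
  then show "E $$ (i, j) = 0\<^sub>m n k $$ (i, j)"
    unfolding eq using ij add_left_cancel[of "M $$ (i, j)" "E $$ (i, j)" 0] by simp
qed (use E in auto)

theorem theoremS3:
  fixes A P Pinv J2 :: "real mat" and \<mu> :: complex and d m r :: nat and T :: real
  assumes "T > 0"
    and "A \<in> carrier_mat d d"
    and "no_nilpotent_jordan_block A"
    and "m \<ge> 2"
    and "Polynomial.order \<mu> (char_poly (map_mat complex_of_real A)) = m"
    and "d = lead_dim \<mu> m + r"
    and "J2 \<in> carrier_mat r r"
    and "semisimple_real_form J2"
    and "similar_mat_wit A (block_diag2 (lead_block \<mu> m) J2) P Pinv"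
  shows "\<forall>x0 \<in> carrier_vec d.
           \<not> identifiable T A x0 \<and>
           (let v = vec_first (Pinv *\<^sub>v x0) (lead_dim \<mu> m) in
              (\<exists>U. admissible \<mu> m v U) \<and>
              (\<forall>U D. admissible \<mu> m v U \<longrightarrow>
                 D \<in> carrier_mat (perturb_dim \<mu> m) (perturb_dim \<mu> m) \<longrightarrow>
                 P * block_diag2 (lead_block \<mu> m + U * D * U\<^sup>T) J2 * Pinv
                   \<in> unidentifiable_class T A x0))"
proof
  fix x0 :: "real vec" assume x0: "x0 \<in> carrier_vec d"
  let ?n = "lead_dim \<mu> m" and ?k = "perturb_dim \<mu> m" and ?L = "lead_block \<mu> m"
  define v where "v = vec_first (Pinv *\<^sub>v x0) ?n"
  define B where "B U D = P * block_diag2 (?L + U * D * U\<^sup>T) J2 * Pinv" for U D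
  have v: "v \<in> carrier_vec ?n" by (simp add: v_def)
  note wit = similar_mat_witD2[OF assms(2,9)]
  have block: "block_diag2 (?L + U * D * U\<^sup>T) J2 \<in> carrier_mat d d"
    if "U \<in> carrier_mat ?n ?k" for U D
    using that assms(6,7) lead_block_carrier[of \<mu> m] by (auto intro!: block_diag2_carrier)
  have B_carrier: "B U D \<in> carrier_mat d d" if "U \<in> carrier_mat ?n ?k" for U D
    using wit block[OF that] by (auto simp: B_def)
  have in_class: "B U D \<in> unidentifiable_class T A x0"
    if adm: "admissible \<mu> m v U" and D: "D \<in> carrier_mat ?k ?k" for U D
  proof -
    have U: "U \<in> carrier_mat ?n ?k" and vW: "v \<in> annihilated_vecs \<mu> m U"
      using adm by (auto simp: admissible_iff[OF v])
    have "trajectory t A x0 = trajectory t (B U D) x0" for t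
      unfolding B_def
    proof (rule trajectory_perturbed[where W = "annihilated_vecs \<mu> m U" and n = ?n and r = r])
      fix w assume w: "w \<in> annihilated_vecs \<mu> m U"
      then have "w \<in> carrier_vec ?n" "U\<^sup>T *\<^sub>v w = 0\<^sub>v ?k"
        using U by (auto simp: annihilated_vecs_def)
      moreover have "(U * D * U\<^sup>T) *\<^sub>v w = (U * D) *\<^sub>v (U\<^sup>T *\<^sub>v w)"
        using U D \<open>w \<in> carrier_vec ?n\<close> by (intro assoc_mult_mat_vec) auto
      moreover have "M *\<^sub>v 0\<^sub>v ?k = 0\<^sub>v ?n" if "M \<in> carrier_mat ?n ?k" for M :: "real mat"
        using that by (intro eq_vecI) auto
      note this[OF mult_carrier_mat[OF U D]]
      ultimately show "(U * D * U\<^sup>T) *\<^sub>v w = 0\<^sub>v ?n"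
        by simp
    qed (use assms x0 U vW lead_block_carrier annihilated_vecs_smult[OF U]
          annihilated_vecs_lead_block[OF U] in \<open>auto simp: v_def annihilated_vecs_def\<close>)
    then show ?thesis
      using B_carrier[OF U] assms(2) by (auto simp: unidentifiable_class_def)
  qed
  have "m \<ge> 1" using assms(4) by simp
  then have ex: "\<exists>U. admissible \<mu> m v U" by (rule admissible_exists[OF v])
  have "\<not> identifiable T A x0"
  proof -
    obtain U where adm: "admissible \<mu> m v U" using ex by blast
    have U: "U \<in> carrier_mat ?n ?k" and so: "semi_orthogonal U"
      using adm by (auto simp: admissible_iff[OF v])
    have k: "?k \<ge> 1" using assms(4) by (auto simp: perturb_dim_def)
    \<comment> \<open>Any non-zero \<open>D\<close> would do; the identity is one because \<open>?k\<close> is positive.\<close>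
    let ?E = "U * 1\<^sub>m ?k * U\<^sup>T"
    have E: "?E \<in> carrier_mat ?n ?n" using U by auto
    have "B U (1\<^sub>m ?k) \<noteq> A"
    proof
      assume "B U (1\<^sub>m ?k) = A"
      then have "P * block_diag2 (?L + ?E) J2 * Pinv = P * block_diag2 ?L J2 * Pinv"
        unfolding B_def wit(3)[symmetric] .
      then have "block_diag2 (?L + ?E) J2 = block_diag2 ?L J2"
        by (rule similar_mat_conjugation_cancel[OF wit(2,6,7) block[OF U] wit(5)])
      then have "?L + ?E = ?L"
        by (rule block_diag2_eqD[OF add_carrier_mat[OF E] lead_block_carrier assms(7)])
      then have "?E = 0\<^sub>m ?n ?n"
        by (rule add_eq_self_mat[OF lead_block_carrier E])
      then have "1\<^sub>m ?k = (0\<^sub>m ?k ?k :: real mat)"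
        by (rule semi_orthogonal_conjugation_inj[OF U so one_carrier_mat])
      then have "1\<^sub>m ?k $$ (0, 0) = (0\<^sub>m ?k ?k :: real mat) $$ (0, 0)" by simp
      then show False using k by simp
    qed
    moreover have "B U (1\<^sub>m ?k) \<in> unidentifiable_class T A x0"
      using in_class[OF adm] by auto
    ultimately show ?thesis
      unfolding identifiable_def unidentifiable_class_def by fastforce
  qed
  then show "\<not> identifiable T A x0 \<and>
           (let v = vec_first (Pinv *\<^sub>v x0) ?n in
              (\<exists>U. admissible \<mu> m v U) \<and>
              (\<forall>U D. admissible \<mu> m v U \<longrightarrow> D \<in> carrier_mat ?k ?k \<longrightarrow>
                 P * block_diag2 (?L + U * D * U\<^sup>T) J2 * Pinv \<in> unidentifiable_class T A x0))"
    using ex in_class by (simp add: v_def B_def Let_def)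
qed

end
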